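(* Let $F$ and $G$ be $q$-varieties and $\psi:F\to G$ a morphism. Then $\psi(F)$ is a $q$-variety.
   Context: $p$ prime, $K$ algebraically closed of characteristic $p$, $q$ a power of $p$. $K\{\tau\}$ is the ring (under composition) of $\mathbb{F}_q$-linear polynomials $\sum a_iX^{q^i}$, $a_i\in K$. $\Lambda_n$ is the set of polynomials $\sum_{i=1}^nP_i(X_i)$, $P_i\in K\{\tau\}$. A $q$-variety in $K^n$ is a set $\{x\in K^n: f(x)=0\ \forall f\in S\}$ for some $S\subset\Lambda_n$. A morphism from a $q$-variety $F\subset K^n$ to a $q$-variety $G\subset K^m$ is a map $\psi:F\to G$ of the form $\psi(x)=(f_1(x),\dots,f_m(x))$ with $f_1,\dots,f_m\in\Lambda_n$. *)

theory Defs
  imports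
    "HOL-Computational_Algebra.Computational_Algebra"
    "Jordan_Normal_Form.Matrix"
begin

text \<open>
  The ring \<open>K{\<tau>}\<close>: the polynomials \<open>\<Sum>i. a\<^sub>i X^(q^i)\<close>, as genuine polynomials in one variable.
\<close>

definition qlin_polys :: "nat \<Rightarrow> 'a::comm_ring_1 poly set" where
  "qlin_polys q = {P. \<exists>d a. P = (\<Sum>i<d. monom (a i) (q ^ i))}"

text \<open>
  The set \<open>\<Lambda>\<^sub>n\<close>. The \<open>n\<close>-variable polynomial \<open>P\<^sub>0(X\<^sub>0) + \<dots> + P\<^bsub>n-1\<^esub>(X\<^bsub>n-1\<^esub>)\<close> (variables are
  indexed from \<open>0\<close>) is represented by its evaluation map; over an infinite field, in particular
  over an algebraically closed one, the two determine each other. Only arguments in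
  \<open>carrier_vec n\<close> are meaningful.
\<close>

definition Lambda :: "nat \<Rightarrow> nat \<Rightarrow> ('a::comm_ring_1 vec \<Rightarrow> 'a) set" where
  "Lambda q n =
     {f. \<exists>P. (\<forall>i<n. P i \<in> qlin_polys q) \<and> f = (\<lambda>x. \<Sum>i<n. poly (P i) (x $ i))}"

definition q_variety :: "nat \<Rightarrow> nat \<Rightarrow> 'a::comm_ring_1 vec set \<Rightarrow> bool" where
  "q_variety q n V \<longleftrightarrow> (\<exists>S \<subseteq> Lambda q n. V = {x \<in> carrier_vec n. \<forall>f\<in>S. f x = 0})"

definition q_morphism ::
    "nat \<Rightarrow> nat \<Rightarrow> nat \<Rightarrow> 'a::comm_ring_1 vec set \<Rightarrow> 'a vec set \<Rightarrow> ('a vec \<Rightarrow> 'a vec) \<Rightarrow> bool" where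
  "q_morphism q n m F G \<psi> \<longleftrightarrow>
     \<psi> \<in> F \<rightarrow> G \<and>
     (\<exists>f. (\<forall>j<m. f j \<in> Lambda q n) \<and> (\<forall>x\<in>F. \<psi> x = vec m (\<lambda>j. f j x)))"

end

theory Submission
  imports Defs
begin

text \<open>
  The image of \<open>\<psi>\<close> is the projection to the first \<open>m\<close> coordinates of a \<open>q\<close>-variety in
  \<open>K^(m + n)\<close>, so it suffices to eliminate one variable at a time. The equations vanishing on a
  \<open>q\<close>-variety form a left \<open>K{\<tau>}\<close>-module; right division with remainder in \<open>K{\<tau>}\<close> shows that the
  coefficients of the last variable in these equations are all left multiples of a single
  coefficient \<open>g\<close> of least degree. Subtracting multiples of the equation with coefficient \<open>g\<close>
  leaves equations without the last variable, and a solution of those extends to the last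
  variable because a nonzero \<open>q\<close>-polynomial \<open>g\<close> is surjective on an algebraically closed field.
\<close>

section \<open>Additive polynomials in one variable, as functions\<close>

text \<open>The bound \<open>d\<close> is exclusive and the top coefficient may vanish, so the zero
  function satisfies every bound and is the only one with \<open>d = 0\<close>.\<close>

definition qlin :: "nat \<Rightarrow> nat \<Rightarrow> ('a::comm_ring_1 \<Rightarrow> 'a) \<Rightarrow> bool" where
  "qlin q d f \<longleftrightarrow> (\<exists>a. f = (\<lambda>x. \<Sum>i<d. a i * x ^ (q ^ i)))"

lemma qlin_0_iff: "qlin q 0 f \<longleftrightarrow> f = (\<lambda>_. 0)"
  by (simp add: qlin_def)

lemma qlin_SucD:
  assumes "qlin q (Suc d) f"
  obtains c f' where "qlin q d f'" "f = (\<lambda>x. c * x ^ (q ^ d) + f' x)"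
proof -
  from assms obtain a where "f = (\<lambda>x. \<Sum>i<Suc d. a i * x ^ (q ^ i))"
    unfolding qlin_def by blast
  then show ?thesis
    by (intro that[of "\<lambda>x. \<Sum>i<d. a i * x ^ (q ^ i)" "a d"])
       (auto simp: qlin_def add.commute)
qed

lemma qlin_mono:
  assumes "qlin q d f" "d \<le> e"
  shows "qlin q e f"
proof -
  from assms(1) obtain a where a: "f = (\<lambda>x. \<Sum>i<d. a i * x ^ (q ^ i))"
    unfolding qlin_def by blast
  have "(\<Sum>i<d. a i * x ^ (q ^ i)) = (\<Sum>i<e. (if i < d then a i else 0) * x ^ (q ^ i))" for x
    using assms(2) by (intro sum.mono_neutral_cong_left) auto
  then show ?thesis
    unfolding qlin_def a by (intro exI[of _ "\<lambda>i. if i < d then a i else 0"]) auto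
qed

lemma qlin_zero: "qlin q d (\<lambda>_. 0)"
  using qlin_0_iff qlin_mono by blast

lemma qlin_add:
  assumes "qlin q d f" "qlin q d g"
  shows "qlin q d (\<lambda>x. f x + g x)"
proof -
  from assms obtain a b where
    "f = (\<lambda>x. \<Sum>i<d. a i * x ^ (q ^ i))" "g = (\<lambda>x. \<Sum>i<d. b i * x ^ (q ^ i))"
    unfolding qlin_def by blast
  then show ?thesis
    unfolding qlin_def
    by (intro exI[of _ "\<lambda>i. a i + b i"]) (simp add: sum.distrib distrib_right)
qed

lemma qlin_cmult:
  assumes "qlin q d f"
  shows "qlin q d (\<lambda>x. c * f x)"
proof -
  from assms obtain a where "f = (\<lambda>x. \<Sum>i<d. a i * x ^ (q ^ i))"
    unfolding qlin_def by blast
  then show ?thesis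
    unfolding qlin_def
    by (intro exI[of _ "\<lambda>i. c * a i"]) (simp add: sum_distrib_left mult.assoc)
qed

lemma qlin_monom: "qlin q (Suc d) (\<lambda>x. c * x ^ (q ^ d))"
  unfolding qlin_def by (intro exI[of _ "\<lambda>i. if i = d then c else 0"]) simp

lemma qlin_id: "qlin q 1 (\<lambda>x. x)"
  using qlin_monom[of q 0 1] by simp

definition qlins :: "nat \<Rightarrow> ('a::comm_ring_1 \<Rightarrow> 'a) set" where
  "qlins q = {f. \<exists>d. qlin q d f}"

lemma qlins_zero: "(\<lambda>_. 0) \<in> qlins q"
  using qlin_zero by (auto simp: qlins_def)

lemma qlins_id: "(\<lambda>x. x) \<in> qlins q"
  using qlin_id by (auto simp: qlins_def)

lemma qlins_add:
  assumes "f \<in> qlins q" "g \<in> qlins q"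
  shows "(\<lambda>x. f x + g x) \<in> qlins q"
proof -
  from assms obtain d e where "qlin q d f" "qlin q e g"
    by (auto simp: qlins_def)
  then have "qlin q (max d e) f" "qlin q (max d e) g"
    by (auto intro: qlin_mono)
  then have "qlin q (max d e) (\<lambda>x. f x + g x)"
    by (rule qlin_add)
  then show ?thesis
    by (auto simp: qlins_def)
qed

lemma qlins_cmult: "f \<in> qlins q \<Longrightarrow> (\<lambda>x. c * f x) \<in> qlins q"
  using qlin_cmult by (fastforce simp: qlins_def)

lemma qlins_uminus: "f \<in> qlins q \<Longrightarrow> (\<lambda>x. - f x) \<in> qlins q"
  using qlins_cmult[of f q "-1"] by simp

lemma qlins_diff:
  "f \<in> qlins q \<Longrightarrow> g \<in> qlins q \<Longrightarrow> (\<lambda>x. f x - g x) \<in> qlins q"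
  using qlins_add[OF _ qlins_uminus, of f q g] by simp

lemma qlins_eq_poly: "qlins q = poly ` qlin_polys q"
proof -
  have *: "poly (\<Sum>i<d. monom (a i) (q ^ i)) = (\<lambda>x. \<Sum>i<d. a i * x ^ (q ^ i))"
    for d and a :: "nat \<Rightarrow> 'a"
    by (simp add: fun_eq_iff poly_sum poly_monom)
  show ?thesis
    unfolding qlins_def qlin_polys_def qlin_def image_def Bex_def
    using * by (auto; metis)
qed

text \<open>The family \<open>P\<close> is total: components from index \<open>n\<close> on are
  irrelevant to the sum and can be set to zero, which removes index bounds from later
  arguments.\<close>

lemma Lambda_iff:
  "f \<in> Lambda q n \<longleftrightarrow>
    (\<exists>P. (\<forall>i. P i \<in> qlins q) \<and> f = (\<lambda>x. \<Sum>i<n. P i (x $ i)))"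
proof
  assume "f \<in> Lambda q n"
  then obtain P where P: "\<forall>i<n. P i \<in> qlin_polys q" "f = (\<lambda>x. \<Sum>i<n. poly (P i) (x $ i))"
    unfolding Lambda_def by blast
  then have "(if i < n then poly (P i) else (\<lambda>_. 0)) \<in> qlins q" for i
    using P(1) qlins_zero[of q] by (auto simp: qlins_eq_poly)
  then show "\<exists>P. (\<forall>i. P i \<in> qlins q) \<and> f = (\<lambda>x. \<Sum>i<n. P i (x $ i))"
    using P(2) by (intro exI[of _ "\<lambda>i. if i < n then poly (P i) else (\<lambda>_. 0)"]) simp
next
  assume "\<exists>P. (\<forall>i. P i \<in> qlins q) \<and> f = (\<lambda>x. \<Sum>i<n. P i (x $ i))"
  then obtain P where P: "\<forall>i. P i \<in> qlins q" "f = (\<lambda>x. \<Sum>i<n. P i (x $ i))"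
    by blast
  from P(1) have "\<forall>i. \<exists>Q. Q \<in> qlin_polys q \<and> P i = poly Q"
    unfolding qlins_eq_poly by (simp add: image_iff Bex_def)
  then obtain Q where "\<forall>i. Q i \<in> qlin_polys q \<and> P i = poly (Q i)"
    by (rule choice[THEN exE])
  with P(2) show "f \<in> Lambda q n"
    unfolding Lambda_def by auto
qed

section \<open>Composition and right division in \<open>K{\<tau>}\<close>\<close>

locale frobenius_power =
  fixes q :: nat and ty :: "'a::alg_closed_field itself"
  assumes q_gt_1: "q > 1"
    and q_power_add: "(x + y :: 'a) ^ q = x ^ q + y ^ q"
begin

lemma power_add: "(x + y :: 'a) ^ (q ^ k) = x ^ (q ^ k) + y ^ (q ^ k)"
proof (induction k)
  case (Suc k)
  then show ?case
    by (simp add: power_mult q_power_add mult.commute[of q])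
qed simp

lemma qlins_additive:
  fixes f :: "'a \<Rightarrow> 'a"
  assumes "f \<in> qlins q"
  shows "f (x + y) = f x + f y"
  using assms by (auto simp: qlins_def qlin_def power_add distrib_left sum.distrib)

lemma qlins_at_0:
  fixes f :: "'a \<Rightarrow> 'a"
  assumes "f \<in> qlins q"
  shows "f 0 = 0"
  using qlins_additive[OF assms, of 0 0] by (metis add_0_left add_cancel_right_left)

lemma qlins_sum:
  fixes f :: "'a \<Rightarrow> 'a"
  assumes "f \<in> qlins q"
  shows "f (sum g A) = (\<Sum>i\<in>A. f (g i))"
  by (induction A rule: infinite_finite_induct)
     (auto simp: qlins_additive[OF assms] qlins_at_0[OF assms])

text \<open>Since the \<open>q ^ k\<close>-th power is additive, it acts term by term: coefficients
  are raised to that power and every exponent index moves up by \<open>k\<close>.\<close>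

lemma qlin_power:
  fixes f :: "'a \<Rightarrow> 'a"
  assumes "qlin q d f"
  shows "qlin q (d + k) (\<lambda>x. f x ^ (q ^ k))"
  using assms
proof (induction d arbitrary: f)
  case 0
  then show ?case
    using q_gt_1 by (simp add: qlin_0_iff qlin_zero power_0_left)
next
  case (Suc d)
  from Suc.prems obtain c f' where f: "qlin q d f'" "f = (\<lambda>x. c * x ^ (q ^ d) + f' x)"
    by (rule qlin_SucD)
  have "qlin q (Suc d + k) (\<lambda>x. c ^ (q ^ k) * x ^ (q ^ (d + k)))"
    using qlin_monom[of q "d + k" "c ^ (q ^ k)"] by simp
  moreover have "qlin q (Suc d + k) (\<lambda>x. f' x ^ (q ^ k))"
    using Suc.IH[OF f(1)] by (rule qlin_mono) simp
  ultimately have "qlin q (Suc d + k) (\<lambda>x. c ^ (q ^ k) * x ^ (q ^ (d + k)) + f' x ^ (q ^ k))"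
    by (rule qlin_add)
  then show ?case
    unfolding f(2) by (simp add: power_add power_mult_distrib Power.power_add power_mult)
qed

lemma qlins_compose:
  fixes f g :: "'a \<Rightarrow> 'a"
  assumes "f \<in> qlins q" "g \<in> qlins q"
  shows "(\<lambda>x. f (g x)) \<in> qlins q"
proof -
  from assms(1) obtain d where "qlin q d f"
    by (auto simp: qlins_def)
  then show ?thesis
  proof (induction d arbitrary: f)
    case 0
    then show ?case
      by (simp add: qlin_0_iff qlins_zero)
  next
    case (Suc d)
    from Suc.prems obtain c f' where f: "qlin q d f'" "f = (\<lambda>x. c * x ^ (q ^ d) + f' x)"
      by (rule qlin_SucD)
    have "(\<lambda>x. g x ^ (q ^ d)) \<in> qlins q"
      using assms(2) qlin_power by (fastforce simp: qlins_def)
    then show ?case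
      unfolding f(2) by (intro qlins_add qlins_cmult Suc.IH[OF f(1)])
  qed
qed

text \<open>Long division: as long as the bound of \<open>f\<close> exceeds \<open>k\<close>, a left
  multiple of \<open>g\<close> cancels the top term of \<open>f\<close>. The remainder has bound
  \<open>k\<close>, strictly below that of \<open>g\<close>.\<close>

lemma qlin_right_division:
  fixes f g :: "'a \<Rightarrow> 'a"
  assumes "qlin q d f" and "qlin q k g'" and g: "g = (\<lambda>x. b * x ^ (q ^ k) + g' x)" and "b \<noteq> 0"
  obtains Q r where "Q \<in> qlins q" "qlin q k r" "f = (\<lambda>x. Q (g x) + r x)"
proof -
  have "\<exists>Q\<in>qlins q. qlin q k (\<lambda>x. f x - Q (g x))"
    using assms(1)
  proof (induction d arbitrary: f)
    case 0
    then show ?case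
      by (intro bexI[of _ "\<lambda>_. 0"]) (auto simp: qlin_0_iff qlin_zero qlins_zero)
  next
    case (Suc d)
    show ?case
    proof (cases "Suc d \<le> k")
      case True
      with Suc.prems show ?thesis
        by (intro bexI[of _ "\<lambda>_. 0"]) (auto simp: qlins_zero intro: qlin_mono)
    next
      case False
      from Suc.prems obtain c f' where f: "qlin q d f'" "f = (\<lambda>x. c * x ^ (q ^ d) + f' x)"
        by (rule qlin_SucD)
      define j where "j = d - k"
      have d: "d = k + j"
        using False by (simp add: j_def)
      \<comment> \<open>Chosen so that \<open>s * b ^ (q ^ j) = c\<close>; then
        \<open>s * g x ^ (q ^ j)\<close> has the same top term as \<open>f\<close>.\<close>
      define s where "s = c / b ^ (q ^ j)"
      have g_power: "g x ^ (q ^ j) = b ^ (q ^ j) * x ^ (q ^ d) + g' x ^ (q ^ j)" for x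
        unfolding g d by (simp add: power_add power_mult_distrib Power.power_add power_mult)
      have "f x - s * g x ^ (q ^ j) = f' x + (- s) * g' x ^ (q ^ j)" for x
        using \<open>b \<noteq> 0\<close> unfolding g_power f(2) by (simp add: s_def field_simps)
      moreover have "qlin q d (\<lambda>x. f' x + (- s) * g' x ^ (q ^ j))"
        using qlin_power[OF assms(2), of j] unfolding d[symmetric]
        by (intro qlin_add qlin_cmult f(1))
      ultimately have "qlin q d (\<lambda>x. f x - s * g x ^ (q ^ j))"
        by simp
      from Suc.IH[OF this] obtain Q
        where Q: "Q \<in> qlins q" "qlin q k (\<lambda>x. f x - s * g x ^ (q ^ j) - Q (g x))"
        by blast
      have "(\<lambda>y. s * y ^ (q ^ j) + Q y) \<in> qlins q"
        using qlin_monom Q(1) by (intro qlins_add) (auto simp: qlins_def)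
      then show ?thesis
        using Q(2) by (intro bexI[of _ "\<lambda>y. s * y ^ (q ^ j) + Q y"]) (auto simp: algebra_simps)
    qed
  qed
  then obtain Q where "Q \<in> qlins q" "qlin q k (\<lambda>x. f x - Q (g x))"
    by blast
  then show ?thesis
    by (intro that[of Q "\<lambda>x. f x - Q (g x)"]) auto
qed

text \<open>A preimage of \<open>c\<close> is a root of the polynomial minus \<open>c\<close>, which
  exists because its degree is positive.\<close>

lemma qlin_surj:
  fixes g' :: "'a \<Rightarrow> 'a"
  assumes "qlin q k g'" "b \<noteq> 0"
  shows "\<exists>t. b * t ^ (q ^ k) + g' t = c"
proof -
  from assms(1) obtain a where a: "g' = (\<lambda>x. \<Sum>i<k. a i * x ^ (q ^ i))"
    unfolding qlin_def by blast
  define P where "P = monom b (q ^ k) + (\<Sum>i<k. monom (a i) (q ^ i)) - [:c:]"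
  \<comment> \<open>With \<open>q > 1\<close> the exponents are distinct and positive, so neither
    the lower terms nor the constant \<open>c\<close> can disturb the coefficient \<open>b\<close>
    at \<open>q ^ k\<close>.\<close>
  have "q ^ i \<noteq> q ^ k" if "i < k" for i
    using q_gt_1 that by simp
  moreover have "q ^ k > 0"
    using q_gt_1 by simp
  ultimately have "coeff P (q ^ k) = b"
    by (auto simp: P_def coeff_sum coeff_pCons split: nat.splits)
  then have "q ^ k \<le> degree P"
    using \<open>b \<noteq> 0\<close> by (intro le_degree) simp
  then have "degree P > 0"
    using \<open>q ^ k > 0\<close> by (rule less_le_trans[rotated])
  then obtain t where "poly P t = 0"
    using alg_closed_imp_poly_has_root by blast
  then show ?thesis
    unfolding a by (intro exI[of _ t]) (simp add: P_def poly_sum poly_monom)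
qed

section \<open>Systems of equations and elimination of variables\<close>

definition qrows :: "(nat \<Rightarrow> 'a \<Rightarrow> 'a) set" where
  "qrows = {P. \<forall>i. P i \<in> qlins q}"

text \<open>Assignments are functions on all naturals rather than vectors of length
  \<open>N\<close>, so adding or dropping a variable is a plain function update.\<close>

definition sols :: "nat \<Rightarrow> (nat \<Rightarrow> 'a \<Rightarrow> 'a) set \<Rightarrow> (nat \<Rightarrow> 'a) set" where
  "sols N T = {z. \<forall>P\<in>T. (\<Sum>i<N. P i (z i)) = 0}"

lemma eliminate_last:
  assumes "T \<subseteq> qrows"
  obtains T' where "T' \<subseteq> qrows" "\<And>z. z \<in> sols N T' \<longleftrightarrow> (\<exists>t. z(N := t) \<in> sols (Suc N) T)"
proof
  \<comment> \<open>All equations valid on the solution set, not just combinations of those in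
    \<open>T\<close>; closure under left combinations is then immediate from additivity.\<close>
  define M where "M = {P \<in> qrows. \<forall>z\<in>sols (Suc N) T. (\<Sum>i<Suc N. P i (z i)) = 0}"
  define T' where "T' = {P \<in> M. P N = (\<lambda>_. 0)}"
  show "T' \<subseteq> qrows"
    by (auto simp: T'_def M_def)
  have T_M: "T \<subseteq> M"
    using assms by (auto simp: M_def sols_def)
  have M_closed: "(\<lambda>i x. P i x - Q (P0 i x)) \<in> M" if "P \<in> M" "P0 \<in> M" "Q \<in> qlins q" for P P0 Q
    unfolding M_def
  proof (intro CollectI conjI ballI)
    show "(\<lambda>i x. P i x - Q (P0 i x)) \<in> qrows"
      unfolding qrows_def
    proof (intro CollectI allI)
      fix i
      have "P i \<in> qlins q" "P0 i \<in> qlins q"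
        using that by (auto simp: M_def qrows_def)
      then show "(\<lambda>x. P i x - Q (P0 i x)) \<in> qlins q"
        using qlins_diff qlins_compose[OF that(3)] by blast
    qed
    fix z assume "z \<in> sols (Suc N) T"
    then have "(\<Sum>i<Suc N. P i (z i)) = 0" "(\<Sum>i<Suc N. P0 i (z i)) = 0"
      using that by (auto simp: M_def)
    then show "(\<Sum>i<Suc N. P i (z i) - Q (P0 i (z i))) = 0"
      using that(3) by (simp only: sum_subtractf qlins_sum[OF that(3), symmetric] qlins_at_0 diff_self)
  qed
  fix z
  show "z \<in> sols N T' \<longleftrightarrow> (\<exists>t. z(N := t) \<in> sols (Suc N) T)"
  proof
    assume "\<exists>t. z(N := t) \<in> sols (Suc N) T"
    then obtain t where t: "z(N := t) \<in> sols (Suc N) T" ..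
    show "z \<in> sols N T'"
      unfolding sols_def
    proof (intro CollectI ballI)
      fix P assume "P \<in> T'"
      then have "(\<Sum>i<Suc N. P i ((z(N := t)) i)) = 0" "P N = (\<lambda>_. 0)"
        using t unfolding T'_def M_def by blast+
      then show "(\<Sum>i<N. P i (z i)) = 0"
        by simp
    qed
  next
    assume z: "z \<in> sols N T'"
    have sum_upd: "(\<Sum>i<Suc N. P i ((z(N := t)) i)) = (\<Sum>i<N. P i (z i)) + P N t"
      for P :: "nat \<Rightarrow> 'a \<Rightarrow> 'a" and t
      by simp
    show "\<exists>t. z(N := t) \<in> sols (Suc N) T"
    proof (cases "M \<subseteq> T'")
      case True
      \<comment> \<open>No equation involves the last variable, so any value would do.\<close>
      then have "z(N := 0) \<in> sols (Suc N) T"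
        using z T_M unfolding sols_def sum_upd by (auto simp: T'_def)
      then show ?thesis ..
    next
      case False
      \<comment> \<open>Bounds attained by nonzero last coefficients in \<open>M\<close>; the least
        one singles out the pivot equation \<open>P0\<close>.\<close>
      define deg_le where "deg_le d \<longleftrightarrow> (\<exists>P\<in>M. P N \<noteq> (\<lambda>_. 0) \<and> qlin q d (P N))" for d
      from False obtain P where "P \<in> M" "P N \<noteq> (\<lambda>_. 0)" "P N \<in> qlins q"
        by (auto simp: T'_def M_def qrows_def)
      then have "\<exists>d. deg_le d"
        by (auto simp: deg_le_def qlins_def)
      then obtain d where d: "deg_le d" "\<And>d'. d' < d \<Longrightarrow> \<not> deg_le d'"
        using exists_least_iff[of deg_le] by blast
      from d(1) obtain P0 where P0: "P0 \<in> M" "P0 N \<noteq> (\<lambda>_. 0)" "qlin q d (P0 N)"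
        unfolding deg_le_def by blast
      then obtain k where k: "d = Suc k"
        by (cases d) (auto simp: qlin_0_iff)
      obtain b g' where g': "qlin q k g'" "P0 N = (\<lambda>x. b * x ^ (q ^ k) + g' x)"
        using P0(3) unfolding k by (rule qlin_SucD)
      \<comment> \<open>A vanishing top coefficient would give the smaller bound
        \<open>k\<close>.\<close>
      have "b \<noteq> 0"
      proof
        assume "b = 0"
        then have "deg_le k"
          using P0(1,2) g' by (auto simp: deg_le_def)
        then show False
          using d(2) k by blast
      qed
      \<comment> \<open>This value solves the pivot equation; every other equation will turn out to
        follow from it and those in \<open>T'\<close>.\<close>
      obtain t where t: "P0 N t = - (\<Sum>i<N. P0 i (z i))"
        using qlin_surj[OF g'(1) \<open>b \<noteq> 0\<close>] unfolding g'(2) by blast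
      have "(\<Sum>i<Suc N. P i ((z(N := t)) i)) = 0" if "P \<in> T" for P
      proof -
        have P: "P \<in> M" "P N \<in> qlins q"
          using that T_M by (auto simp: M_def qrows_def)
        then obtain e where "qlin q e (P N)"
          by (auto simp: qlins_def)
        then obtain Q r where Qr: "Q \<in> qlins q" "qlin q k r" "P N = (\<lambda>x. Q (P0 N x) + r x)"
          using g' \<open>b \<noteq> 0\<close> by (rule qlin_right_division)
        let ?P' = "\<lambda>i x. P i x - Q (P0 i x)"
        have P': "?P' \<in> M" "?P' N = r"
          using M_closed[OF P(1) P0(1) Qr(1)] Qr(3) by auto
        \<comment> \<open>The remainder is itself the last coefficient of an equation in
          \<open>M\<close>, with a bound below the least one.\<close>
        have "r = (\<lambda>_. 0)"
        proof (rule ccontr)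
          assume "r \<noteq> (\<lambda>_. 0)"
          then have "deg_le k"
            unfolding deg_le_def using P' Qr(2) by (intro bexI[of _ ?P']) auto
          then show False
            using d(2) k by blast
        qed
        then have "?P' \<in> T'"
          using P' by (simp add: T'_def)
        then have "(\<Sum>i<N. ?P' i (z i)) = 0"
          using z unfolding sols_def by fastforce
        then have "(\<Sum>i<N. P i (z i)) = Q (\<Sum>i<N. P0 i (z i))"
          by (simp add: sum_subtractf qlins_sum[OF Qr(1)])
        moreover have "P N t = Q (P0 N t)"
          using Qr(3) \<open>r = (\<lambda>_. 0)\<close> by simp
        ultimately show ?thesis
          \<comment> \<open>By additivity the left side is \<open>Q\<close> applied to the left side
            of the pivot equation, that is \<open>Q 0 = 0\<close>.\<close>
          unfolding sum_upd by (simp add: t qlins_at_0[OF Qr(1)] flip: qlins_additive[OF Qr(1)])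
      qed
      then show ?thesis
        unfolding sols_def by blast
    qed
  qed
qed

text \<open>Induction on the number of eliminated variables, removing the one of highest index
  first; \<open>T\<close> is arbitrary because each removal changes the system.\<close>

lemma eliminate:
  assumes "T \<subseteq> qrows"
  shows "\<exists>T'\<subseteq>qrows. \<forall>z. z \<in> sols m T' \<longleftrightarrow> (\<exists>w\<in>sols (m + n) T. \<forall>i<m. w i = z i)"
  using assms
proof (induction n arbitrary: T)
  case 0
  \<comment> \<open>Only coordinates below \<open>m\<close> matter, so \<open>T' = T\<close>
    works.\<close>
  have "w \<in> sols m T \<longleftrightarrow> z \<in> sols m T" if "\<forall>i<m. w i = z i" for w z
    using that by (simp add: sols_def)
  then show ?case
    using 0 by auto
next
  case (Suc n)
  obtain T1 where T1: "T1 \<subseteq> qrows"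
    "\<And>z. z \<in> sols (m + n) T1 \<longleftrightarrow> (\<exists>t. z(m + n := t) \<in> sols (Suc (m + n)) T)"
    using eliminate_last[OF Suc.prems] by blast
  obtain T' where T': "T' \<subseteq> qrows"
    "\<And>z. z \<in> sols m T' \<longleftrightarrow> (\<exists>w\<in>sols (m + n) T1. \<forall>i<m. w i = z i)"
    using Suc.IH[OF T1(1)] by blast
  have "(\<exists>w\<in>sols (m + n) T1. \<forall>i<m. w i = z i) \<longleftrightarrow>
      (\<exists>w\<in>sols (m + Suc n) T. \<forall>i<m. w i = z i)" for z
  proof
    assume "\<exists>w\<in>sols (m + n) T1. \<forall>i<m. w i = z i"
    then obtain w t where "w(m + n := t) \<in> sols (m + Suc n) T" "\<forall>i<m. w i = z i"
      by (auto simp: T1(2))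
    then show "\<exists>w\<in>sols (m + Suc n) T. \<forall>i<m. w i = z i"
      by (intro bexI[of _ "w(m + n := t)"]) auto
  next
    assume "\<exists>w\<in>sols (m + Suc n) T. \<forall>i<m. w i = z i"
    then obtain w where w: "w \<in> sols (m + Suc n) T" "\<forall>i<m. w i = z i"
      by blast
    \<comment> \<open>A trivial update, brought into the form of the existential for
      \<open>T1\<close>.\<close>
    from w(1) have "w(m + n := w (m + n)) \<in> sols (Suc (m + n)) T"
      by simp
    then have "w \<in> sols (m + n) T1"
      unfolding T1(2) by blast
    then show "\<exists>w\<in>sols (m + n) T1. \<forall>i<m. w i = z i"
      using w(2) by blast
  qed
  then show ?case
    by (intro exI[of _ T'] conjI allI T'(1)) (simp only: T'(2))
qed

section \<open>Varieties as solution sets, and their images\<close>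

lemma q_variety_iff:
  "q_variety q n V \<longleftrightarrow> (\<exists>T\<subseteq>qrows. V = {x \<in> carrier_vec n. vec_index x \<in> sols n T})"
proof -
  define ev where "ev P x = (\<Sum>i<n. P i (x $ i))" for P :: "nat \<Rightarrow> 'a \<Rightarrow> 'a" and x :: "'a vec"
  have Lambda: "Lambda q n = ev ` qrows"
    unfolding set_eq_iff Lambda_iff image_def qrows_def ev_def[abs_def] by blast
  have sols: "vec_index x \<in> sols n T \<longleftrightarrow> (\<forall>f\<in>ev ` T. f x = 0)" for x T
    by (simp add: sols_def ev_def)
  show ?thesis
    unfolding q_variety_def Lambda sols by (simp add: subset_image_iff ex_simps(1)[symmetric] conj_assoc)
qed

lemma sum_split_add: "(\<Sum>i<m + n. h i) = (\<Sum>i<m. h i) + (\<Sum>i<n. h (m + i))"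
  for h :: "nat \<Rightarrow> 'a"
  by (induction n) (simp_all add: add.assoc)

text \<open>The graph of \<open>\<psi>\<close> is described with the image coordinates in positions
  below \<open>m\<close> and the point of \<open>F\<close> in the \<open>n\<close> positions after
  them, so that elimination removes exactly the latter.\<close>

lemma q_variety_image:
  fixes F :: "'a vec set"
  assumes F: "q_variety q n F" and \<psi>: "q_morphism q n m F G \<psi>"
  shows "q_variety q m (\<psi> ` F)"
proof -
  from F obtain S where S: "S \<subseteq> qrows" "F = {x \<in> carrier_vec n. vec_index x \<in> sols n S}"
    unfolding q_variety_iff by blast
  from \<psi> obtain f where f: "\<forall>j<m. f j \<in> Lambda q n" "\<forall>x\<in>F. \<psi> x = vec m (\<lambda>j. f j x)"
    unfolding q_morphism_def by blast
  from f(1) have "\<forall>j. \<exists>P. j < m \<longrightarrow> (\<forall>i. P i \<in> qlins q) \<and> f j = (\<lambda>x. \<Sum>i<n. P i (x $ i))"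
    unfolding Lambda_iff by blast
  then obtain A where A: "\<And>j i. j < m \<Longrightarrow> A j i \<in> qlins q"
    "\<And>j. j < m \<Longrightarrow> f j = (\<lambda>x. \<Sum>i<n. A j i (x $ i))"
    by metis
  \<comment> \<open>The equations of \<open>F\<close>, shifted to the last \<open>n\<close>
    variables.\<close>
  define lift where "lift P i = (if i < m then (\<lambda>_. 0) else P (i - m))"
    for P :: "nat \<Rightarrow> 'a \<Rightarrow> 'a" and i
  \<comment> \<open>The equation saying that coordinate \<open>j\<close> equals \<open>f j\<close>
    at the point formed by the last \<open>n\<close> variables.\<close>
  define graph where "graph j i = (if i < m then if i = j then (\<lambda>x. x) else (\<lambda>_. 0)
      else (\<lambda>x. - A j (i - m) x))" for j i
  define T where "T = lift ` S \<union> graph ` {..<m}"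
  have "lift P \<in> qrows" if "P \<in> S" for P
    using S(1) that by (auto simp: lift_def qrows_def qlins_zero)
  moreover have "graph j \<in> qrows" if "j < m" for j
    using that by (auto simp: graph_def qrows_def qlins_zero qlins_id A(1) qlins_uminus)
  ultimately have "T \<subseteq> qrows"
    by (auto simp: T_def)
  then obtain T' where T': "T' \<subseteq> qrows"
    "\<And>z. z \<in> sols m T' \<longleftrightarrow> (\<exists>w\<in>sols (m + n) T. \<forall>i<m. w i = z i)"
    using eliminate[of T m n] by auto
  have lift_sum: "(\<Sum>i<m + n. lift P i (w i)) = (\<Sum>i<n. P i (w (m + i)))" for P w
    by (simp add: sum_split_add lift_def)
  have graph_sum: "(\<Sum>i<m + n. graph j i (w i)) = w j - (\<Sum>i<n. A j i (w (m + i)))"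
    if "j < m" for j w
  proof -
    have "(\<Sum>i<m. graph j i (w i)) = (\<Sum>i<m. if i = j then w i else 0)"
      by (intro sum.cong) (auto simp: graph_def)
    then show ?thesis
      using that by (simp add: sum_split_add graph_def sum_negf)
  qed
  have T_iff: "w \<in> sols (m + n) T \<longleftrightarrow>
      vec n (\<lambda>i. w (m + i)) \<in> F \<and> (\<forall>j<m. w j = f j (vec n (\<lambda>i. w (m + i))))" for w
  proof -
    have "w \<in> sols (m + n) T \<longleftrightarrow> (\<forall>P\<in>S. (\<Sum>i<n. P i (w (m + i))) = 0) \<and>
        (\<forall>j<m. w j = (\<Sum>i<n. A j i (w (m + i))))"
      unfolding sols_def T_def by (simp add: ball_Un lift_sum graph_sum) (simp add: Ball_def)
    also have "(\<forall>P\<in>S. (\<Sum>i<n. P i (w (m + i))) = 0) \<longleftrightarrow> vec n (\<lambda>i. w (m + i)) \<in> F"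
      by (simp add: S(2) sols_def)
    also have "(\<forall>j<m. w j = (\<Sum>i<n. A j i (w (m + i)))) \<longleftrightarrow>
        (\<forall>j<m. w j = f j (vec n (\<lambda>i. w (m + i))))"
      by (simp add: A(2))
    finally show ?thesis .
  qed
  have "\<psi> ` F = {y \<in> carrier_vec m. vec_index y \<in> sols m T'}"
  proof (intro equalityI subsetI)
    fix y assume "y \<in> \<psi> ` F"
    then obtain x where x: "x \<in> F" "y = vec m (\<lambda>j. f j x)"
      using f(2) by auto
    \<comment> \<open>The concatenation of \<open>y\<close> and \<open>x\<close>, a point of the
      graph.\<close>
    define w where "w i = (if i < m then y $ i else x $ (i - m))" for i
    have "vec n (\<lambda>i. w (m + i)) = x"
      using x(1) S(2) by (intro eq_vecI) (auto simp: w_def)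
    then have "w \<in> sols (m + n) T"
      unfolding T_iff using x by (simp add: w_def)
    then have "vec_index y \<in> sols m T'"
      unfolding T'(2) by (intro bexI[of _ w]) (auto simp: w_def)
    then show "y \<in> {y \<in> carrier_vec m. vec_index y \<in> sols m T'}"
      using x(2) by simp
  next
    fix y assume y: "y \<in> {y \<in> carrier_vec m. vec_index y \<in> sols m T'}"
    then obtain w where w: "w \<in> sols (m + n) T" "\<forall>i<m. w i = y $ i"
      unfolding T'(2) by blast
    let ?x = "vec n (\<lambda>i. w (m + i))"
    have "?x \<in> F" "\<forall>j<m. y $ j = f j ?x"
      using w unfolding T_iff by auto
    moreover from this have "y = \<psi> ?x"
      using y f(2) by (intro eq_vecI) auto
    ultimately show "y \<in> \<psi> ` F"
      by blast
  qed
  then show ?thesis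
    unfolding q_variety_iff using T'(1) by blast
qed

end

theorem theorem3p4:
  fixes F G :: "'a::alg_closed_field vec set"
    and \<psi> :: "'a vec \<Rightarrow> 'a vec"
    and p q n m :: nat
  assumes "prime p" and "CHAR('a) = p"
    and "\<exists>e\<ge>1. q = p ^ e"
    and "q_variety q n F" and "q_variety q m G"
    and "q_morphism q n m F G \<psi>"
  shows "q_variety q m (\<psi> ` F)"
proof -
  from assms(3) obtain e where e: "e \<ge> 1" "q = p ^ e"
    by blast
  \<comment> \<open>The characteristic enters here, through additivity of the
    \<open>p ^ e\<close>-th power; \<open>e \<ge> 1\<close> ensures \<open>q > 1\<close>.\<close>
  interpret frobenius_power q "TYPE('a)"
  proof
    show "q > 1"
      unfolding e(2) using e(1) prime_gt_1_nat[OF assms(1)] by (intro one_less_power) auto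
    show "(x + y) ^ q = x ^ q + y ^ q" for x y :: 'a
      using assms(1) e(2) unfolding assms(2)[symmetric] by (rule freshmans_dream')
  qed
  show ?thesis
    using assms(4,6) by (rule q_variety_image)
qed

end
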